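(* Let $V$ be a two-dimensional real vector space endowed with a non-degenerate symplectic bilinear form (determinant form) $[\cdot,\cdot]$, and let $\gamma\subset V$ be a closed curve which is the boundary of a convex body and is centered at the origin (i.e. $\gamma=-\gamma$). Then $\gamma$ is a Radon curve if and only if there exists a number $\lambda>0$ such that $|[x,y]|=\lambda$ whenever $x,y\in\gamma$ are such that the direction $y$ supports $\mathrm{conv}(\gamma)$ at $x$.
   Context: The origin of $V$ is denoted $o$. A convex body is a compact convex set with interior points. A direction $y\neq o$ supports a convex body $K$ at $x\in\partial K$ if the line $\{x+ty:t\in\mathbb{R}\}$ is a supporting line of $K$. Radon curves. A curve $\gamma\subset V$ is a Radon curve if it arises from the following construction. Take linearly independent $v,w\in V$ and let $[\cdot,\cdot]_{v,w}$ be the non-degenerate symplectic bilinear form on $V$ with $[v,w]_{v,w}=1$ (a rescaling of the given form $[\cdot,\cdot]$). Let $\gamma_1$ be a curve connecting $v$ and $w$, with $\gamma_1\subseteq\mathrm{conv}\{o,v,w,v+w\}$, such that the union of $\gamma_1$ with the segments from $o$ to $v$ and from $o$ to $w$ is the boundary of a convex body. Let $\gamma_2$ be the curve $$\gamma_2(\lambda)=\frac{(1-\lambda)w+\lambda(-v)}{\sup_{x\in\gamma_1}|[x,(1-\lambda)w+\lambda(-v)]_{v,w}|},\qquad \lambda\in[0,1].$$ Then $\gamma=\gamma_1\cup\gamma_2\cup(-\gamma_1)\cup(-\gamma_2)$. *)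

theory Defs
  imports "HOL-Analysis.Analysis"
begin

text \<open>
  The plane \<open>V\<close> is a type of class \<open>euclidean_space\<close> with \<open>DIM('a) = 2\<close>. The class is
  used for the canonical topology of \<open>V\<close>; the inner product occurs in none of the
  definitions below.
\<close>

definition symplectic_form :: "('a::euclidean_space \<Rightarrow> 'a \<Rightarrow> real) \<Rightarrow> bool" where
  "symplectic_form \<omega> \<longleftrightarrow>
     bilinear \<omega> \<and> (\<forall>x. \<omega> x x = 0) \<and> (\<forall>x. (\<forall>y. \<omega> x y = 0) \<longrightarrow> x = 0)"

definition convex_body :: "'a::euclidean_space set \<Rightarrow> bool" where
  "convex_body K \<longleftrightarrow> compact K \<and> convex K \<and> interior K \<noteq> {}"

text \<open>In dimension 2, the lines are the level sets of the nonzero linear functionals.\<close>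

definition supporting_line :: "'a::euclidean_space set \<Rightarrow> 'a set \<Rightarrow> bool" where
  "supporting_line K L \<longleftrightarrow>
     L \<inter> K \<noteq> {} \<and>
     (\<exists>(f :: 'a \<Rightarrow> real) b. linear f \<and> (\<exists>z. f z \<noteq> 0) \<and> L = {z. f z = b} \<and> (\<forall>z\<in>K. f z \<le> b))"

definition direction_supports :: "'a::euclidean_space \<Rightarrow> 'a set \<Rightarrow> 'a \<Rightarrow> bool" where
  "direction_supports y K x \<longleftrightarrow>
     y \<noteq> 0 \<and> x \<in> frontier K \<and> supporting_line K {x + t *\<^sub>R y | t. t \<in> UNIV}"

definition radon_arc2 ::
    "('a::euclidean_space \<Rightarrow> 'a \<Rightarrow> real) \<Rightarrow> 'a \<Rightarrow> 'a \<Rightarrow> 'a set \<Rightarrow> real \<Rightarrow> 'a" where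
  "radon_arc2 \<omega> v w \<gamma>1 t =
     (let u = (1 - t) *\<^sub>R w + t *\<^sub>R (- v) in (1 / (SUP x\<in>\<gamma>1. \<bar>\<omega> x u\<bar>)) *\<^sub>R u)"

text \<open>
  The form \<open>\<omega>\<close> is the normalized form of the construction: in dimension 2 the condition
  \<open>\<omega> v w = 1\<close> determines it uniquely. The curve from \<open>v\<close> to \<open>w\<close> is
  taken to be simple (an \<open>arc\<close>), which excludes parametrizations that also
  run along the segments from the origin.
\<close>

definition radon_curve :: "'a::euclidean_space set \<Rightarrow> bool" where
  "radon_curve \<gamma> \<longleftrightarrow>
     (\<exists>v w \<omega> g \<gamma>1 \<gamma>2.
        v \<noteq> w \<and> independent {v, w} \<and>
        symplectic_form \<omega> \<and> \<omega> v w = 1 \<and>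
        arc g \<and> pathstart g = v \<and> pathfinish g = w \<and> \<gamma>1 = path_image g \<and>
        \<gamma>1 \<subseteq> convex hull {0, v, w, v + w} \<and>
        (\<exists>K. convex_body K \<and> frontier K = \<gamma>1 \<union> closed_segment 0 v \<union> closed_segment 0 w) \<and>
        \<gamma>2 = radon_arc2 \<omega> v w \<gamma>1 ` {0..1} \<and>
        \<gamma> = \<gamma>1 \<union> \<gamma>2 \<union> uminus ` \<gamma>1 \<union> uminus ` \<gamma>2)"

end

(*
  Let h(y) be the maximum of |[x,y]| over x in \<gamma>. A direction y supports conv \<gamma> at x exactly
  when x attains this maximum, so the condition on supporting pairs says that h = c on \<gamma>: up to
  scaling, the dual norm is the norm with unit sphere \<gamma>.

  If \<gamma> is a Radon curve, \<gamma>1 and \<gamma>2 lie in the parallelograms with vertices 0, v, v+w, w and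
  0, w, w-v, -v, which bounds the form on pairs from the same quadrant by 1; for mixed pairs the
  bound is the normalization of \<gamma>2. Equality for y in \<gamma>1 holds because a support functional of
  conv \<gamma> at y can be chosen nonnegative on v and w, so that its kernel direction meets \<gamma>2.

  Conversely, take v in \<gamma> and a maximizer w of the form against v. Both coordinates of points
  of \<gamma> are then at most 1 in absolute value, so that for u between w and -v the supremum of
  |[x,u]| over \<gamma>1 is already the supremum over \<gamma>.
*)
theory Submission
  imports Defs
begin

section \<open>Symplectic planes\<close>

locale symplectic_plane =
  fixes \<omega> :: "'a::euclidean_space \<Rightarrow> 'a \<Rightarrow> real"
  assumes dim2: "DIM('a) = 2" and symplectic: "symplectic_form \<omega>"
begin

lemma bilin: "bilinear \<omega>"
  and self [simp]: "\<omega> x x = 0"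
  and nondegenerate: "(\<And>y. \<omega> x y = 0) \<Longrightarrow> x = 0"
  using symplectic by (auto simp: symplectic_form_def)

lemmas form_simps =
  bilinear_ladd[OF bilin] bilinear_radd[OF bilin] bilinear_lsub[OF bilin] bilinear_rsub[OF bilin]
  bilinear_lmul[OF bilin, simplified] bilinear_rmul[OF bilin, simplified]
  bilinear_lneg[OF bilin] bilinear_rneg[OF bilin] bilinear_lzero[OF bilin] bilinear_rzero[OF bilin]

lemma antisym: "\<omega> y x = - \<omega> x y"
  using self[of "x + y"] by (simp add: form_simps del: self) (simp add: self)

lemma linear_left: "linear (\<lambda>x. \<omega> x y)"
  using bilin by (simp add: bilinear_def)

lemma linear_right: "linear (\<lambda>y. \<omega> x y)"
  using bilin by (simp add: bilinear_def)

lemma continuous_form [continuous_intros]: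
  fixes S :: "'b::t2_space set"
  assumes "continuous_on S f" "continuous_on S g"
  shows "continuous_on S (\<lambda>x. \<omega> (f x) (g x))"
  using bilinear_continuous_on_compose[OF assms bilin] .

lemma exists_dual:
  assumes "x \<noteq> 0"
  obtains y where "\<omega> x y = 1"
proof -
  obtain y where "\<omega> x y \<noteq> 0" using nondegenerate assms by blast
  then have "\<omega> x ((1 / \<omega> x y) *\<^sub>R y) = 1" by (simp add: form_simps)
  with that show ?thesis by blast
qed

section \<open>Coordinates with respect to a symplectic basis\<close>

lemma normalized_independent:
  assumes "\<omega> v w = 1"
  shows "v \<noteq> w" "independent {v, w}"
proof -
  show vw: "v \<noteq> w" using assms by auto
  have "v \<noteq> k *\<^sub>R w" for k using assms by (auto simp: form_simps)
  moreover have "w \<noteq> 0" using assms by (auto simp: form_simps)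
  ultimately show "independent {v, w}"
    using vw by (auto simp: independent_insert span_singleton)
qed

text \<open>Cramer's rule: \<open>v\<close> and \<open>w\<close> span the plane, and pairing an
  expansion of \<open>z\<close> with \<open>w\<close> and with \<open>v\<close> isolates its two
  coefficients.\<close>

lemma coordinates:
  assumes "\<omega> v w = 1"
  shows "z = \<omega> z w *\<^sub>R v + \<omega> v z *\<^sub>R w"
proof -
  note ind = normalized_independent[OF assms]
  have "card {v, w} = DIM('a)" using ind dim2 by simp
  then have "span {v, w} = UNIV"
    using ind(2) by (metis card_eq_dim dim_UNIV independent_imp_finite subset_UNIV top.extremum_unique)
  then have "z \<in> span {v, w}" by simp
  then obtain a b where "z = a *\<^sub>R v + b *\<^sub>R w"
    by (auto simp: span_insert span_singleton algebra_simps)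
  then show ?thesis using assms by (simp add: form_simps)
qed

lemma form_coordinates:
  assumes "\<omega> v w = 1"
  shows "\<omega> x y = \<omega> x w * \<omega> v y - \<omega> v x * \<omega> y w"
proof -
  have "\<omega> x y = \<omega> (\<omega> x w *\<^sub>R v + \<omega> v x *\<^sub>R w) (\<omega> y w *\<^sub>R v + \<omega> v y *\<^sub>R w)"
    using coordinates[OF assms] by metis
  also have "\<dots> = \<omega> x w * \<omega> v y - \<omega> v x * \<omega> y w"
    using assms antisym[of w v] by (simp add: form_simps algebra_simps)
  finally show ?thesis .
qed

text \<open>Turns the hull condition of \<open>radon_curve\<close> into inequalities between form
  values, the shape in which it is both used and established.\<close>

lemma parallelogram_hull:
  assumes "\<omega> v w = 1"
  shows "z \<in> convex hull {0, v, w, v + w} \<longleftrightarrow> \<omega> z w \<in> {0..1} \<and> \<omega> v z \<in> {0..1}"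
    (is "z \<in> ?P \<longleftrightarrow> _")
proof
  assume "z \<in> ?P"
  moreover have "?P \<subseteq> (\<lambda>z. \<omega> z w) -` {0..1} \<inter> (\<lambda>z. \<omega> v z) -` {0..1}"
    using assms
    by (intro hull_minimal convex_Int convex_linear_vimage linear_left linear_right)
      (auto simp: form_simps)
  ultimately show "\<omega> z w \<in> {0..1} \<and> \<omega> v z \<in> {0..1}" by blast
next
  define a b where "a = \<omega> z w" and "b = \<omega> v z"
  assume "\<omega> z w \<in> {0..1} \<and> \<omega> v z \<in> {0..1}"
  then have ab: "0 \<le> a" "a \<le> 1" "0 \<le> b" "b \<le> 1" by (auto simp: a_def b_def)
  have "{0, v, w, v + w} \<subseteq> ?P" by (rule hull_subset)
  then have P: "0 \<in> ?P" "v \<in> ?P" "w \<in> ?P" "v + w \<in> ?P" by auto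
  \<comment> \<open>Interpolation along the two sides parallel to \<open>w\<close> with weight
    \<open>b\<close>, then between them with weight \<open>a\<close>, reaches the point with
    coordinates \<open>a\<close>, \<open>b\<close>.\<close>
  have "(1 - b) *\<^sub>R 0 + b *\<^sub>R w \<in> ?P" "(1 - b) *\<^sub>R v + b *\<^sub>R (v + w) \<in> ?P"
    using P ab by (intro convexD[OF convex_convex_hull]; force)+
  then have "(1 - a) *\<^sub>R ((1 - b) *\<^sub>R 0 + b *\<^sub>R w) + a *\<^sub>R ((1 - b) *\<^sub>R v + b *\<^sub>R (v + w)) \<in> ?P"
    (is "?A \<in> _") by (rule convexD[OF convex_convex_hull]) (use ab in auto)
  also have "?A = a *\<^sub>R v + b *\<^sub>R w"
    by (simp add: algebra_simps)
  finally show "z \<in> ?P" using coordinates[OF assms, of z] by (simp add: a_def b_def)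
qed

text \<open>A functional vanishing at \<open>y\<close> is determined by its value at any
  \<open>q\<close> with \<open>\<omega> y q = 1\<close>; the factor is \<open>- f q\<close>.\<close>

lemma functional_representation:
  assumes "linear f" "f y = 0" "y \<noteq> 0"
  obtains k :: real where "\<And>z. f z = k * \<omega> z y"
proof -
  obtain q where q: "\<omega> y q = 1" using exists_dual assms(3) by blast
  have "f z = (- f q) * \<omega> z y" for z
  proof -
    have "f z = f (\<omega> z q *\<^sub>R y + \<omega> y z *\<^sub>R q)" using coordinates[OF q] by metis
    also have "\<dots> = \<omega> y z * f q"
      using assms by (simp add: linear_add linear_scale)
    finally show ?thesis using antisym[of y z] by simp
  qed
  with that show ?thesis by blast
qed

lemma parallel:
  assumes "\<omega> z y = 0" "y \<noteq> 0"
  obtains t where "z = t *\<^sub>R y"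
proof -
  obtain q where q: "\<omega> y q = 1" using exists_dual assms(2) by blast
  have "z = \<omega> z q *\<^sub>R y" using coordinates[OF q, of z] antisym[of y z] assms by simp
  with that show ?thesis by blast
qed

end

text \<open>Alternating forms on a plane have a single parameter, the value on a basis. This links
  the given form to the normalized form of a Radon curve.\<close>

lemma symplectic_forms_proportional:
  assumes "symplectic_plane B" "symplectic_plane \<omega>"
  obtains k where "k \<noteq> 0" "\<And>x y. B x y = k * \<omega> x y"
proof -
  interpret B: symplectic_plane B by fact
  interpret symplectic_plane \<omega> by fact
  obtain v :: 'a where "v \<noteq> 0" using dim2 by (metis DIM_positive nonempty_Basis nonzero_Basis ex_in_conv)
  then obtain w where vw: "\<omega> v w = 1" using exists_dual by blast
  have *: "B x y = B v w * \<omega> x y" for x y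
  proof -
    have "B x y = B (\<omega> x w *\<^sub>R v + \<omega> v x *\<^sub>R w) (\<omega> y w *\<^sub>R v + \<omega> v y *\<^sub>R w)"
      using coordinates[OF vw] by metis
    then show ?thesis
      unfolding form_coordinates[OF vw, of x y]
      using B.antisym[of w v] by (simp add: B.form_simps algebra_simps)
  qed
  then have "B v w \<noteq> 0" using B.nondegenerate[of v] \<open>v \<noteq> 0\<close> by fastforce
  with * that show ?thesis by blast
qed

section \<open>Centrally symmetric convex bodies\<close>

locale symmetric_body =
  fixes K \<gamma> :: "'a::euclidean_space set"
  assumes body: "convex_body K" and frontier: "frontier K = \<gamma>" and symmetric: "uminus ` \<gamma> = \<gamma>"
begin

lemma compact_body: "compact K" and convex_body: "convex K"
  using body by (auto simp: convex_body_def)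

text \<open>Lets the support condition, stated for \<open>convex hull \<gamma>\<close>, be read as
  one about \<open>K\<close>, and passes the symmetry of \<open>\<gamma>\<close> on to
  \<open>K\<close>.\<close>

lemma hull: "convex hull \<gamma> = K"
  using Krein_Milman_frontier[OF convex_body compact_body, symmetric] unfolding frontier .

lemma minus_curve [simp]: "- x \<in> \<gamma> \<longleftrightarrow> x \<in> \<gamma>"
proof -
  have "- z \<in> \<gamma>" if "z \<in> \<gamma>" for z
    using imageI[OF that, of uminus] unfolding symmetric .
  from this[of x] this[of "- x"] show ?thesis by auto
qed

lemma minus_body: "uminus ` K = K"
proof -
  have "linear (uminus :: 'a \<Rightarrow> 'a)" by (simp add: linear_iff)
  from convex_hull_linear_image[OF this, of \<gamma>] show ?thesis
    unfolding symmetric hull .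
qed

text \<open>The origin is the midpoint of an interior point and its reflection.\<close>

lemma origin_interior: "0 \<in> interior K"
proof -
  obtain x where x: "x \<in> interior K" using body by (auto simp: convex_body_def)
  then have "- x \<in> interior K"
    using imageI[OF x, of uminus] interior_negations[of K] unfolding minus_body by simp
  with x have "(1/2) *\<^sub>R x + (1/2) *\<^sub>R (- x) \<in> interior K"
    by (intro convexD[OF convex_interior[OF convex_body]]) auto
  then show ?thesis by simp
qed

lemma curve_nonzero: "y \<in> \<gamma> \<Longrightarrow> y \<noteq> 0"
  using origin_interior unfolding frontier[symmetric] frontier_def by blast

lemma curve_subset: "\<gamma> \<subseteq> K"
  unfolding hull[symmetric] by (rule hull_subset)

lemma compact_curve: "compact \<gamma>"
  unfolding frontier[symmetric] by (rule compact_frontier[OF compact_body])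

text \<open>Polar coordinates around the interior point 0: \<open>s\<close> is the gauge of
  \<open>K\<close> at \<open>x\<close>. The ray through \<open>x\<close> meets the frontier at
  \<open>d *\<^sub>R x\<close>, whence \<open>s = 1 / d\<close>.\<close>

lemma ray:
  assumes "x \<noteq> 0"
  obtains s y where "s > 0" "y \<in> \<gamma>" "x = s *\<^sub>R y" "x \<in> K \<longleftrightarrow> s \<le> 1"
proof -
  obtain d where "0 < d" "0 + d *\<^sub>R x \<in> frontier K"
    and "\<And>e. \<lbrakk>0 \<le> e; e < d\<rbrakk> \<Longrightarrow> 0 + e *\<^sub>R x \<in> interior K"
    using ray_to_frontier[OF compact_imp_bounded[OF compact_body] origin_interior assms] by blast
  then have d: "0 < d" "d *\<^sub>R x \<in> \<gamma>" and int: "\<And>e. \<lbrakk>0 \<le> e; e < d\<rbrakk> \<Longrightarrow> e *\<^sub>R x \<in> interior K"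
    unfolding frontier by simp_all
  have "x \<in> K \<longleftrightarrow> 1 \<le> d"
  proof
    assume "x \<in> K"
    show "1 \<le> d"
    proof (rule ccontr)
      assume "\<not> 1 \<le> d"
      \<comment> \<open>For \<open>d < 1\<close> the frontier point \<open>d *\<^sub>R x\<close>
        would lie strictly between the interior point 0 and \<open>x \<in> K\<close>, hence be
        interior.\<close>
      then have "x - (1 - d) *\<^sub>R (x - 0) \<in> interior K"
        using d(1) by (intro mem_interior_convex_shrink[OF convex_body origin_interior \<open>x \<in> K\<close>]) simp_all
      then have "d *\<^sub>R x \<in> interior K" by (simp add: algebra_simps)
      with d(2) show False unfolding frontier[symmetric] frontier_def by blast
    qed
  next
    assume "1 \<le> d"
    show "x \<in> K"
    proof (cases "d = 1")
      case True
      then show ?thesis using d(2) curve_subset by auto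
    next
      case False
      then have "1 *\<^sub>R x \<in> interior K" using \<open>1 \<le> d\<close> by (intro int) simp_all
      then show ?thesis using interior_subset[of K] by auto
    qed
  qed
  with d show ?thesis by (intro that[of "1 / d" "d *\<^sub>R x"]) simp_all
qed

end

section \<open>The support condition\<close>

text \<open>Says that the dual norm \<open>y \<mapsto> sup {\<bar>\<omega> x y\<bar> | x. x \<in> K}\<close> of a body with boundary \<open>\<gamma>\<close>
  coincides with the norm whose unit sphere is \<open>\<gamma>\<close>.\<close>

definition self_polar :: "('a \<Rightarrow> 'a \<Rightarrow> real) \<Rightarrow> 'a set \<Rightarrow> bool" where
  "self_polar \<omega> \<gamma> \<longleftrightarrow> (\<forall>y\<in>\<gamma>. (\<forall>x\<in>\<gamma>. \<bar>\<omega> x y\<bar> \<le> 1) \<and> (\<exists>x\<in>\<gamma>. \<bar>\<omega> x y\<bar> = 1))"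

locale symplectic_body = symplectic_plane \<omega> + symmetric_body K \<gamma>
  for \<omega> :: "'a::euclidean_space \<Rightarrow> 'a \<Rightarrow> real" and K \<gamma> :: "'a set"
begin

lemma form_bounded_body:
  assumes "\<And>x. x \<in> \<gamma> \<Longrightarrow> \<bar>\<omega> x y\<bar> \<le> c" "0 \<le> c" "z \<in> K"
  shows "\<bar>\<omega> z y\<bar> \<le> c"
proof (cases "z = 0")
  case False
  then obtain s x where sx: "s > 0" "x \<in> \<gamma>" "z = s *\<^sub>R x" "z \<in> K \<longleftrightarrow> s \<le> 1" by (rule ray)
  have "s * \<bar>\<omega> x y\<bar> \<le> 1 * c"
    using assms(1)[OF sx(2)] assms(2,3) sx(1,4) by (intro mult_mono) simp_all
  with sx(1) show ?thesis unfolding sx(3) by (simp add: form_simps abs_mult)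
next
  case True
  then show ?thesis using assms(2) by (simp add: form_simps)
qed

text \<open>The maximum exists by compactness. It is positive because some \<open>q\<close> pairs
  with \<open>y\<close> to 1, and so the radial projection of \<open>q\<close> to
  \<open>\<gamma>\<close> has a nonzero pairing.\<close>

lemma exists_maximizer:
  assumes "y \<noteq> 0"
  obtains x where "x \<in> \<gamma>" "\<And>z. z \<in> \<gamma> \<Longrightarrow> \<bar>\<omega> z y\<bar> \<le> \<bar>\<omega> x y\<bar>" "\<bar>\<omega> x y\<bar> > 0"
proof -
  obtain q where q: "\<omega> y q = 1" using exists_dual assms by blast
  then have "q \<noteq> 0" by (auto simp: form_simps)
  then obtain s z where z: "s > 0" "z \<in> \<gamma>" "q = s *\<^sub>R z" by (rule ray)
  have "\<omega> y q = s * \<omega> y z" unfolding z(3) by (simp add: form_simps)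
  then have "\<omega> z y \<noteq> 0" using q antisym[of y z] by auto
  have "continuous_on \<gamma> (\<lambda>z. \<bar>\<omega> z y\<bar>)" by (intro continuous_intros)
  then obtain x where "x \<in> \<gamma>" "\<And>z. z \<in> \<gamma> \<Longrightarrow> \<bar>\<omega> z y\<bar> \<le> \<bar>\<omega> x y\<bar>"
    using continuous_attains_sup[OF compact_curve] z(2) by blast
  moreover from this(2)[OF z(2)] have "\<bar>\<omega> x y\<bar> > 0" using \<open>\<omega> z y \<noteq> 0\<close> by linarith
  ultimately show ?thesis using that by blast
qed

text \<open>A functional constant on a line of direction \<open>y\<close> is a multiple of
  \<open>\<lambda>z. \<omega> z y\<close>; the symmetry of \<open>\<gamma>\<close> turns its
  one-sided bound into a bound on absolute values.\<close>

lemma direction_supports_iff: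
  assumes "x \<in> \<gamma>" "y \<noteq> 0"
  shows "direction_supports y K x \<longleftrightarrow> (\<forall>z\<in>\<gamma>. \<bar>\<omega> z y\<bar> \<le> \<bar>\<omega> x y\<bar>)"
proof
  assume "direction_supports y K x"
  then obtain f :: "'a \<Rightarrow> real" and b where f: "linear f" "{x + t *\<^sub>R y | t. t \<in> UNIV} = {z. f z = b}"
    "\<And>z. z \<in> K \<Longrightarrow> f z \<le> b" and nz: "\<exists>z. f z \<noteq> 0"
    unfolding direction_supports_def supporting_line_def by blast
  have fl: "f (x + t *\<^sub>R y) = b" for t
  proof -
    have "x + t *\<^sub>R y \<in> {z. f z = b}" unfolding f(2)[symmetric] by blast
    then show ?thesis by simp
  qed
  from fl[of 0] fl[of 1] have fx: "f x = b" and "f y = 0"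
    using f(1) by (auto simp: linear_add)
  then obtain k where k: "\<And>z. f z = k * \<omega> z y"
    using functional_representation[OF f(1) _ assms(2)] by metis
  then have "k \<noteq> 0" using nz by auto
  show "\<forall>z\<in>\<gamma>. \<bar>\<omega> z y\<bar> \<le> \<bar>\<omega> x y\<bar>"
  proof
    fix z assume "z \<in> \<gamma>"
    then have "z \<in> K" "- z \<in> K" using curve_subset minus_curve by blast+
    then have "f z \<le> f x" "f (- z) \<le> f x" using f(3) fx by auto
    then have "\<bar>k * \<omega> z y\<bar> \<le> \<bar>k * \<omega> x y\<bar>" unfolding k by (simp add: form_simps)
    then show "\<bar>\<omega> z y\<bar> \<le> \<bar>\<omega> x y\<bar>" using \<open>k \<noteq> 0\<close> by (simp add: abs_mult)
  qed
next
  assume max: "\<forall>z\<in>\<gamma>. \<bar>\<omega> z y\<bar> \<le> \<bar>\<omega> x y\<bar>"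
  obtain x' where "x' \<in> \<gamma>" "\<bar>\<omega> x' y\<bar> > 0" using exists_maximizer[OF assms(2)] by blast
  with max have nz: "\<omega> x y \<noteq> 0" by force
  \<comment> \<open>The sign makes the value at \<open>x\<close> equal to
    \<open>\<bar>\<omega> x y\<bar>\<close>, so that \<open>x\<close> lies on the upper supporting
    line.\<close>
  define f where "f z = sgn (\<omega> x y) * \<omega> z y" for z
  have lin: "linear f" unfolding f_def using linear_left[of y]
    by (simp add: linear_iff algebra_simps)
  have nz_f: "f x \<noteq> 0" using nz by (simp add: f_def sgn_if)
  have line: "{x + t *\<^sub>R y | t. t \<in> UNIV} = {z. f z = \<bar>\<omega> x y\<bar>}"
  proof (intro set_eqI iffI)
    fix z assume "z \<in> {z. f z = \<bar>\<omega> x y\<bar>}"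
    then have "\<omega> (z - x) y = 0" using nz by (auto simp: f_def form_simps sgn_if split: if_splits)
    then obtain t where "z - x = t *\<^sub>R y" using parallel assms(2) by metis
    then have "z = x + t *\<^sub>R y" by (simp add: algebra_simps)
    then show "z \<in> {x + t *\<^sub>R y | t. t \<in> UNIV}" by blast
  qed (auto simp: f_def form_simps sgn_if)
  have le: "f z \<le> \<bar>\<omega> x y\<bar>" if "z \<in> K" for z
  proof -
    have "\<bar>\<omega> z y\<bar> \<le> \<bar>\<omega> x y\<bar>" using form_bounded_body[OF _ _ that] max by auto
    then show ?thesis by (auto simp: f_def sgn_if)
  qed
  have x: "x \<in> {x + t *\<^sub>R y | t. t \<in> UNIV} \<inter> K"
    using assms curve_subset by (auto intro!: exI[of _ 0])
  have "supporting_line K {x + t *\<^sub>R y | t. t \<in> UNIV}"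
    unfolding supporting_line_def using x lin nz_f line le
    by (intro conjI exI[of _ f] exI[of _ "\<bar>\<omega> x y\<bar>"] exI[of _ x] ballI) blast+
  then show "direction_supports y K x"
    unfolding direction_supports_def frontier using assms by blast
qed

text \<open>Every \<open>y\<close> has a maximizer and supports the body there, so the left side
  says that the maximum over \<open>\<gamma>\<close> is \<open>c\<close> for each \<open>y\<close>.
  Conversely, a supporting pair attains this maximum.\<close>

lemma support_condition_iff:
  assumes "c > 0"
  shows "(\<forall>x\<in>\<gamma>. \<forall>y\<in>\<gamma>. direction_supports y (convex hull \<gamma>) x \<longrightarrow> \<bar>\<omega> x y\<bar> = c)
    \<longleftrightarrow> self_polar (\<lambda>x y. \<omega> x y / c) \<gamma>" (is "?L \<longleftrightarrow> ?R")
proof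
  assume L: ?L
  show ?R unfolding self_polar_def
  proof
    fix y assume y: "y \<in> \<gamma>"
    obtain x where x: "x \<in> \<gamma>" "\<And>z. z \<in> \<gamma> \<Longrightarrow> \<bar>\<omega> z y\<bar> \<le> \<bar>\<omega> x y\<bar>"
      using exists_maximizer[OF curve_nonzero[OF y]] by blast
    then have "direction_supports y (convex hull \<gamma>) x"
      using direction_supports_iff[OF x(1) curve_nonzero[OF y]] unfolding hull by blast
    then have "\<bar>\<omega> x y\<bar> = c" using L x(1) y by blast
    then have "\<bar>\<omega> z y / c\<bar> \<le> 1" if "z \<in> \<gamma>" for z using x(2)[OF that] assms by simp
    moreover have "\<bar>\<omega> x y / c\<bar> = 1" using \<open>\<bar>\<omega> x y\<bar> = c\<close> assms by simp
    ultimately show "(\<forall>x\<in>\<gamma>. \<bar>\<omega> x y / c\<bar> \<le> 1) \<and> (\<exists>x\<in>\<gamma>. \<bar>\<omega> x y / c\<bar> = 1)"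
      using x(1) by blast
  qed
next
  assume R: ?R
  show ?L
  proof (intro ballI impI)
    fix x y assume xy: "x \<in> \<gamma>" "y \<in> \<gamma>" and "direction_supports y (convex hull \<gamma>) x"
    then have "\<forall>z\<in>\<gamma>. \<bar>\<omega> z y\<bar> \<le> \<bar>\<omega> x y\<bar>"
      using direction_supports_iff[OF xy(1) curve_nonzero[OF xy(2)]] unfolding hull by blast
    moreover have "\<bar>\<omega> x y / c\<bar> \<le> 1" "\<exists>x\<in>\<gamma>. \<bar>\<omega> x y / c\<bar> = 1"
      using R xy unfolding self_polar_def by blast+
    ultimately show "\<bar>\<omega> x y\<bar> = c" using assms by (auto simp: field_simps)
  qed
qed

end

section \<open>From Radon curves to the support condition\<close>

context symplectic_body
begin

lemma supporting_functional:
  assumes "y \<in> \<gamma>"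
  obtains f :: "'a \<Rightarrow> real" where "linear f" "f y > 0" "\<And>z. z \<in> \<gamma> \<Longrightarrow> f z \<le> f y"
proof -
  obtain a where a: "a \<noteq> 0" "\<And>z. z \<in> K \<Longrightarrow> a \<bullet> y \<le> a \<bullet> z"
  proof -
    have "rel_interior K = interior K"
      using origin_interior by (intro rel_interior_nonempty_interior) auto
    then have "y \<in> K" "y \<notin> rel_interior K"
      using assms curve_subset frontier by (auto simp: frontier_def)
    then show ?thesis
      using supporting_hyperplane_rel_boundary[OF convex_body] that by metis
  qed
  have K: "- a \<bullet> z \<le> - a \<bullet> y" if "z \<in> \<gamma>" for z
    using a(2)[of z] that curve_subset by auto
  have "- a \<noteq> 0" using a by simp
  \<comment> \<open>The functional is positive at the point of \<open>\<gamma>\<close> in direction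
    \<open>- a\<close>, hence also at its maximizer \<open>y\<close>.\<close>
  then obtain s z where z: "s > 0" "z \<in> \<gamma>" "- a = s *\<^sub>R z" by (rule ray)
  have "- a \<bullet> z > 0" using z curve_nonzero[OF z(2)] by (simp add: z(3))
  with K[OF z(2)] have "- a \<bullet> y > 0" by linarith
  moreover have "linear (\<lambda>z. - a \<bullet> z)" by (simp add: linear_iff inner_right_distrib)
  ultimately show ?thesis using that K by blast
qed

text \<open>In coordinates a support functional at \<open>y\<close> has the coefficients
  \<open>f v\<close> and \<open>f w\<close>. If both are nonnegative, division by their sum gives
  the weights \<open>1 - t\<close> and \<open>t\<close>. If one is negative, the other coordinate
  functional is already maximal at \<open>y\<close>, and an end value of \<open>t\<close>
  serves.\<close>

lemma support_direction_in_quadrant: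
  assumes vw: "\<omega> v w = 1" and "v \<in> \<gamma>" "w \<in> \<gamma>" and y: "y \<in> \<gamma>"
    and coords: "\<omega> y w \<in> {0..1}" "\<omega> v y \<in> {0..1}"
    and \<gamma>1: "\<And>z. z \<in> \<gamma>1 \<Longrightarrow> z \<in> \<gamma> \<and> \<omega> z w \<in> {0..1} \<and> \<omega> v z \<in> {0..1}"
  obtains t where "t \<in> {0..1}"
    "\<And>z. z \<in> \<gamma>1 \<Longrightarrow> \<omega> z ((1 - t) *\<^sub>R w + t *\<^sub>R (- v)) \<le> \<omega> y ((1 - t) *\<^sub>R w + t *\<^sub>R (- v))"
proof -
  obtain f :: "'a \<Rightarrow> real" where f: "linear f" "f y > 0" "\<And>z. z \<in> \<gamma> \<Longrightarrow> f z \<le> f y"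
    using supporting_functional[OF y] by blast
  have fz: "f z = \<omega> z w * f v + \<omega> v z * f w" for z
  proof -
    have "f z = f (\<omega> z w *\<^sub>R v + \<omega> v z *\<^sub>R w)" using coordinates[OF vw] by metis
    then show ?thesis using f(1) by (simp add: linear_add linear_scale)
  qed
  have uz: "\<omega> z ((1 - t) *\<^sub>R w + t *\<^sub>R (- v)) = \<omega> z w * (1 - t) + \<omega> v z * t" for z t
    using antisym[of z v] by (simp add: form_simps)
  have fv: "f v \<le> f y" "f w \<le> f y" using f assms by auto
  consider "f v \<ge> 0" "f w \<ge> 0" | "f v < 0" | "f w < 0" by linarith
  then show ?thesis
  proof cases
    case 1
    have pos: "f v + f w > 0"
    proof (rule ccontr)
      assume "\<not> f v + f w > 0"
      then have "f v = 0" "f w = 0" using 1 by auto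
      with f(2) fz[of y] show False by simp
    qed
    show ?thesis
    proof (rule that[of "f w / (f v + f w)"])
      have eq: "1 - f w / (f v + f w) = f v / (f v + f w)" using pos by (simp add: field_simps)
      show "\<omega> z ((1 - f w / (f v + f w)) *\<^sub>R w + (f w / (f v + f w)) *\<^sub>R (- v))
          \<le> \<omega> y ((1 - f w / (f v + f w)) *\<^sub>R w + (f w / (f v + f w)) *\<^sub>R (- v))" if "z \<in> \<gamma>1" for z
      proof -
        have "f z / (f v + f w) \<le> f y / (f v + f w)"
          using f(3)[of z] \<gamma>1[OF that] pos by (intro divide_right_mono) auto
        then show ?thesis unfolding uz unfolding eq fz[of z] fz[of y] by (simp add: add_divide_distrib)
      qed
    qed (use 1 pos in auto)
  next
    case 2
    have *: "\<omega> y w * f v \<le> 0" using 2 coords by (simp add: mult_nonneg_nonpos)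
    then have "\<omega> v y * f w > 0" using f(2) fz[of y] by linarith
    then have "f w > 0" using coords by (simp add: zero_less_mult_iff)
    moreover have "f w \<le> \<omega> v y * f w" using * fv(2) fz[of y] by linarith
    \<comment> \<open>Since \<open>f v < 0\<close>, the inequality \<open>f w \<le> f y\<close> is
      possible only if the second coordinate of \<open>y\<close> reaches its upper bound on the
      parallelogram.\<close>
    ultimately have le: "1 \<le> \<omega> v y" by simp
    show ?thesis
    proof (rule that[of 1])
      show "\<omega> z ((1 - 1) *\<^sub>R w + 1 *\<^sub>R (- v)) \<le> \<omega> y ((1 - 1) *\<^sub>R w + 1 *\<^sub>R (- v))"
        if "z \<in> \<gamma>1" for z
        unfolding uz using \<gamma>1[OF that] le by simp
    qed simp
  next
    case 3
    have *: "\<omega> v y * f w \<le> 0" using 3 coords by (simp add: mult_nonneg_nonpos)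
    then have "\<omega> y w * f v > 0" using f(2) fz[of y] by linarith
    then have "f v > 0" using coords by (simp add: zero_less_mult_iff)
    moreover have "f v \<le> \<omega> y w * f v" using * fv(1) fz[of y] by linarith
    ultimately have le: "1 \<le> \<omega> y w" by simp
    show ?thesis
    proof (rule that[of 0])
      show "\<omega> z ((1 - 0) *\<^sub>R w + 0 *\<^sub>R (- v)) \<le> \<omega> y ((1 - 0) *\<^sub>R w + 0 *\<^sub>R (- v))"
        if "z \<in> \<gamma>1" for z
        unfolding uz using \<gamma>1[OF that] le by simp
    qed simp
  qed
qed

lemma radon_imp_self_polar:
  assumes vw: "\<omega> v w = 1" and "v \<in> \<gamma>1" "w \<in> \<gamma>1" and "compact \<gamma>1"
    and hull: "\<gamma>1 \<subseteq> convex hull {0, v, w, v + w}"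
    and \<gamma>2: "\<gamma>2 = radon_arc2 \<omega> v w \<gamma>1 ` {0..1}"
    and \<gamma>: "\<gamma> = \<gamma>1 \<union> \<gamma>2 \<union> uminus ` \<gamma>1 \<union> uminus ` \<gamma>2"
  shows "self_polar \<omega> \<gamma>"
proof -
  define u where "u t = (1 - t) *\<^sub>R w + t *\<^sub>R (- v)" for t :: real
  define S where "S t = (SUP x\<in>\<gamma>1. \<bar>\<omega> x (u t)\<bar>)" for t
  have coords: "\<omega> z w \<in> {0..1}" "\<omega> v z \<in> {0..1}" if "z \<in> \<gamma>1" for z
    using hull parallelogram_hull[OF vw] that by blast+
  have uz: "\<omega> z (u t) = \<omega> z w * (1 - t) + \<omega> v z * t" for z t
    using antisym[of z v] by (simp add: form_simps u_def)
  have uz_nonneg: "\<omega> z (u t) \<ge> 0" if "z \<in> \<gamma>1" "t \<in> {0..1}" for z t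
    using coords[OF that(1)] that(2) by (simp add: uz)
  have max: "\<exists>x\<in>\<gamma>1. S t = \<bar>\<omega> x (u t)\<bar> \<and> (\<forall>z\<in>\<gamma>1. \<bar>\<omega> z (u t)\<bar> \<le> \<bar>\<omega> x (u t)\<bar>)" for t
  proof -
    have "continuous_on \<gamma>1 (\<lambda>z. \<bar>\<omega> z (u t)\<bar>)" by (intro continuous_intros)
    then obtain x where x: "x \<in> \<gamma>1" "\<And>z. z \<in> \<gamma>1 \<Longrightarrow> \<bar>\<omega> z (u t)\<bar> \<le> \<bar>\<omega> x (u t)\<bar>"
      using continuous_attains_sup[OF \<open>compact \<gamma>1\<close>] \<open>v \<in> \<gamma>1\<close> by blast
    then have "S t = \<bar>\<omega> x (u t)\<bar>" unfolding S_def by (intro cSup_eq_maximum) auto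
    with x show ?thesis by blast
  qed
  then have upper: "\<bar>\<omega> z (u t)\<bar> \<le> S t" if "z \<in> \<gamma>1" for z t
    using that by metis
  \<comment> \<open>Against \<open>u t\<close> the form takes the value \<open>1 - t\<close> at
    \<open>v\<close> and \<open>t\<close> at \<open>w\<close>.\<close>
  have S: "1 - t \<le> S t" "t \<le> S t" "0 < S t" if "t \<in> {0..1}" for t
    using upper[OF \<open>v \<in> \<gamma>1\<close>, of t] upper[OF \<open>w \<in> \<gamma>1\<close>, of t] that vw
    by (auto simp: uz)
  have \<gamma>2_iff: "y \<in> \<gamma>2 \<longleftrightarrow> (\<exists>t\<in>{0..1}. y = (1 / S t) *\<^sub>R u t)" for y
    by (auto simp: \<gamma>2 radon_arc2_def Let_def S_def u_def)
  have coords2: "- \<omega> y w \<in> {0..1}" "\<omega> v y \<in> {0..1}" if "y \<in> \<gamma>2" for y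
  proof -
    obtain t where t: "t \<in> {0..1}" "y = (1 / S t) *\<^sub>R u t" using \<open>y \<in> \<gamma>2\<close> \<gamma>2_iff by blast
    have "- \<omega> y w = t / S t" "\<omega> v y = (1 - t) / S t"
      using vw by (simp_all add: t(2) form_simps u_def)
    then show "- \<omega> y w \<in> {0..1}" "\<omega> v y \<in> {0..1}"
      using S[OF t(1)] t(1) by auto
  qed
  have cross: "\<bar>\<omega> x y\<bar> \<le> 1" if "x \<in> \<gamma>1" "y \<in> \<gamma>2" for x y
  proof -
    obtain t where t: "t \<in> {0..1}" "y = (1 / S t) *\<^sub>R u t" using \<open>y \<in> \<gamma>2\<close> \<gamma>2_iff by blast
    then show ?thesis using upper[OF that(1), of t] S[OF t(1)]
      by (simp add: form_simps abs_mult field_simps)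
  qed
  have unit: "a * b \<in> {0..1}" if "a \<in> {0..1}" "b \<in> {0..1}" for a b :: real
    using that mult_mono[of a 1 b 1] by simp
  \<comment> \<open>Within one quadrant the two products in the coordinate determinant have the same
    sign and absolute value at most 1, and so has their difference absolute value at most 1.\<close>
  have same: "\<bar>\<omega> x y\<bar> \<le> 1" if "x \<in> \<gamma>1 \<and> y \<in> \<gamma>1 \<or> x \<in> \<gamma>2 \<and> y \<in> \<gamma>2" for x y
    using that
  proof (elim disjE conjE)
    assume x: "x \<in> \<gamma>1" and y: "y \<in> \<gamma>1"
    have "\<omega> x w * \<omega> v y \<in> {0..1}" "\<omega> v x * \<omega> y w \<in> {0..1}"
      using unit[OF coords(1)[OF x] coords(2)[OF y]] unit[OF coords(2)[OF x] coords(1)[OF y]] .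
    then show ?thesis unfolding form_coordinates[OF vw, of x y] atLeastAtMost_iff by (simp add: abs_le_iff)
  next
    assume x: "x \<in> \<gamma>2" and y: "y \<in> \<gamma>2"
    have "- \<omega> x w * \<omega> v y \<in> {0..1}" "\<omega> v x * - \<omega> y w \<in> {0..1}"
      using unit[OF coords2(1)[OF x] coords2(2)[OF y]] unit[OF coords2(2)[OF x] coords2(1)[OF y]] .
    then show ?thesis unfolding form_coordinates[OF vw, of x y] atLeastAtMost_iff by (simp add: abs_le_iff)
  qed
  have bound: "\<bar>\<omega> x y\<bar> \<le> 1" if "x \<in> \<gamma>1 \<union> \<gamma>2" "y \<in> \<gamma>1 \<union> \<gamma>2" for x y
  proof -
    have "\<bar>\<omega> x y\<bar> = \<bar>\<omega> y x\<bar>" using antisym[of x y] by simp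
    then show ?thesis using that same[of x y] cross[of x y] cross[of y x] by auto
  qed
  have attained: "\<exists>x\<in>\<gamma>1 \<union> \<gamma>2. \<bar>\<omega> x y\<bar> = 1" if "y \<in> \<gamma>1 \<union> \<gamma>2" for y
    using that
  proof
    assume y: "y \<in> \<gamma>1"
    have sub: "\<gamma>1 \<subseteq> \<gamma>" unfolding \<gamma> by blast
    have "z \<in> \<gamma> \<and> \<omega> z w \<in> {0..1} \<and> \<omega> v z \<in> {0..1}" if "z \<in> \<gamma>1" for z
      using sub coords that by blast
    then obtain t where t: "t \<in> {0..1}" "\<And>z. z \<in> \<gamma>1 \<Longrightarrow> \<omega> z (u t) \<le> \<omega> y (u t)"
      unfolding u_def using assms(2,3) y by (rule_tac support_direction_in_quadrant[OF vw, of y \<gamma>1]) blast+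
    obtain x where x: "x \<in> \<gamma>1" "S t = \<bar>\<omega> x (u t)\<bar>" using max by blast
    \<comment> \<open>The point \<open>y\<close> is one of the maximizers defining
      \<open>S t\<close>, so the normalized \<open>u t\<close>, a point of \<open>\<gamma>2\<close>,
      pairs with \<open>y\<close> to absolute value 1.\<close>
    have "S t = \<omega> y (u t)"
      using t(2)[OF x(1)] x(2) upper[OF y, of t] uz_nonneg[OF x(1) t(1)] by simp
    then have "\<bar>\<omega> ((1 / S t) *\<^sub>R u t) y\<bar> = 1"
      using S[OF t(1)] antisym[of y "u t"] by (simp add: form_simps)
    moreover have "(1 / S t) *\<^sub>R u t \<in> \<gamma>2" using \<gamma>2_iff t(1) by blast
    ultimately show ?thesis by blast
  next
    assume "y \<in> \<gamma>2"
    then obtain t where t: "t \<in> {0..1}" "y = (1 / S t) *\<^sub>R u t" using \<gamma>2_iff by blast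
    obtain x where "x \<in> \<gamma>1" "S t = \<bar>\<omega> x (u t)\<bar>" using max by blast
    then have "\<bar>\<omega> x y\<bar> = 1" using S[OF t(1)] by (simp add: t(2) form_simps abs_mult)
    with \<open>x \<in> \<gamma>1\<close> show ?thesis by blast
  qed
  \<comment> \<open>Changes of sign do not affect \<open>\<bar>\<omega> x y\<bar>\<close>, so the
    facts on half of the curve extend to all of it.\<close>
  have half: "\<exists>y'\<in>\<gamma>1 \<union> \<gamma>2. y = y' \<or> y = - y'" if "y \<in> \<gamma>" for y
    using that unfolding \<gamma> by blast
  show ?thesis unfolding self_polar_def
  proof (intro ballI conjI)
    fix y assume "y \<in> \<gamma>"
    then obtain y' where y': "y' \<in> \<gamma>1 \<union> \<gamma>2" "y = y' \<or> y = - y'" using half by blast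
    then have abs_y: "\<bar>\<omega> x y\<bar> = \<bar>\<omega> x y'\<bar>" for x by (auto simp: form_simps)
    show "\<bar>\<omega> x y\<bar> \<le> 1" if "x \<in> \<gamma>" for x
    proof -
      obtain x' where x': "x' \<in> \<gamma>1 \<union> \<gamma>2" "x = x' \<or> x = - x'" using half \<open>x \<in> \<gamma>\<close> by blast
      then have "\<bar>\<omega> x y\<bar> = \<bar>\<omega> x' y'\<bar>" unfolding abs_y by (auto simp: form_simps)
      with bound x'(1) y'(1) show ?thesis by simp
    qed
    show "\<exists>x\<in>\<gamma>. \<bar>\<omega> x y\<bar> = 1" 
    proof -
      have "\<gamma>1 \<union> \<gamma>2 \<subseteq> \<gamma>" unfolding \<gamma> by blast
      then show ?thesis using attained[OF y'(1)] unfolding abs_y by blast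
    qed
  qed
qed

end

section \<open>From the support condition to Radon curves\<close>

locale self_polar_body = symplectic_body +
  assumes self_polar: "self_polar \<omega> \<gamma>"
begin

text \<open>By self-polarity this dual norm is also the gauge of \<open>K\<close>
  (\<open>body_iff\<close>, \<open>curve_iff\<close>), so it describes \<open>K\<close>,
  \<open>\<gamma>\<close> and the normalization of the second arc at once.\<close>

definition dual_norm :: "'a \<Rightarrow> real" where
  "dual_norm u = (SUP x\<in>\<gamma>. \<bar>\<omega> x u\<bar>)"

lemma curve_bound: "x \<in> \<gamma> \<Longrightarrow> y \<in> \<gamma> \<Longrightarrow> \<bar>\<omega> x y\<bar> \<le> 1"
  using self_polar by (auto simp: self_polar_def)

lemma dual_norm_attained:
  obtains x where "x \<in> \<gamma>" "dual_norm u = \<bar>\<omega> x u\<bar>" "\<And>z. z \<in> \<gamma> \<Longrightarrow> \<bar>\<omega> z u\<bar> \<le> \<bar>\<omega> x u\<bar>"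
proof -
  obtain b :: 'a where "b \<in> Basis" using nonempty_Basis by blast
  then obtain s z where "z \<in> \<gamma>" using ray nonzero_Basis by metis
  moreover have "continuous_on \<gamma> (\<lambda>z. \<bar>\<omega> z u\<bar>)" by (intro continuous_intros)
  ultimately obtain x where x: "x \<in> \<gamma>" "\<And>z. z \<in> \<gamma> \<Longrightarrow> \<bar>\<omega> z u\<bar> \<le> \<bar>\<omega> x u\<bar>"
    using continuous_attains_sup[OF compact_curve] by blast
  then have "dual_norm u = \<bar>\<omega> x u\<bar>" unfolding dual_norm_def by (intro cSup_eq_maximum) auto
  with x that show ?thesis by blast
qed

lemma dual_norm_upper: "x \<in> \<gamma> \<Longrightarrow> \<bar>\<omega> x u\<bar> \<le> dual_norm u"
  by (rule dual_norm_attained[of u]) auto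

lemma dual_norm_curve: "y \<in> \<gamma> \<Longrightarrow> dual_norm y = 1"
  using self_polar dual_norm_attained[of y] unfolding self_polar_def by (metis order_antisym)

lemma dual_norm_scale: "dual_norm (s *\<^sub>R u) = \<bar>s\<bar> * dual_norm u"
proof (rule order_antisym)
  obtain x where "x \<in> \<gamma>" "dual_norm (s *\<^sub>R u) = \<bar>\<omega> x (s *\<^sub>R u)\<bar>" by (rule dual_norm_attained)
  with dual_norm_upper[of x u] show "dual_norm (s *\<^sub>R u) \<le> \<bar>s\<bar> * dual_norm u"
    by (simp add: form_simps abs_mult mult_left_mono)
next
  obtain x where "x \<in> \<gamma>" "dual_norm u = \<bar>\<omega> x u\<bar>" by (rule dual_norm_attained)
  with dual_norm_upper[of x "s *\<^sub>R u"] show "\<bar>s\<bar> * dual_norm u \<le> dual_norm (s *\<^sub>R u)"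
    by (simp add: form_simps abs_mult)
qed

lemma dual_norm_zero [simp]: "dual_norm 0 = 0"
  using dual_norm_scale[of 0 0] by simp

lemma dual_norm_pos: "u \<noteq> 0 \<Longrightarrow> dual_norm u > 0"
  by (erule ray) (simp add: dual_norm_scale dual_norm_curve)

text \<open>A supremum of absolute values of linear functionals is convex, and a finite convex
  function on the whole space is continuous.\<close>

lemma continuous_dual_norm: "continuous_on S dual_norm"
proof -
  have "convex_on UNIV dual_norm"
  proof
    fix t :: real and x y :: 'a assume t: "t > 0" "t < 1"
    obtain z where z: "z \<in> \<gamma>" and
      eq: "dual_norm ((1 - t) *\<^sub>R x + t *\<^sub>R y) = \<bar>\<omega> z ((1 - t) *\<^sub>R x + t *\<^sub>R y)\<bar>"
      by (rule dual_norm_attained)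
    note eq
    also have "\<dots> \<le> (1 - t) * \<bar>\<omega> z x\<bar> + t * \<bar>\<omega> z y\<bar>"
      using t abs_triangle_ineq[of "(1 - t) * \<omega> z x" "t * \<omega> z y"]
      by (simp add: form_simps abs_mult)
    also have "\<dots> \<le> (1 - t) * dual_norm x + t * dual_norm y"
      using t dual_norm_upper[OF z] by (intro add_mono mult_left_mono) auto
    finally show "dual_norm ((1 - t) *\<^sub>R x + t *\<^sub>R y) \<le> (1 - t) * dual_norm x + t * dual_norm y" .
  qed simp
  then show ?thesis
    using convex_on_continuous[OF open_UNIV] continuous_on_subset by blast
qed

lemma body_iff: "x \<in> K \<longleftrightarrow> dual_norm x \<le> 1"
proof (cases "x = 0")
  case False
  then obtain s y where "s > 0" "y \<in> \<gamma>" "x = s *\<^sub>R y" "x \<in> K \<longleftrightarrow> s \<le> 1" by (rule ray)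
  then show ?thesis by (simp add: dual_norm_scale dual_norm_curve)
qed (use origin_interior interior_subset in auto)

lemma curve_iff: "x \<in> \<gamma> \<longleftrightarrow> dual_norm x = 1"
proof
  assume x: "dual_norm x = 1"
  then have "x \<noteq> 0" by auto
  then obtain s y where "s > 0" "y \<in> \<gamma>" "x = s *\<^sub>R y" by (rule ray)
  with x show "x \<in> \<gamma>" by (simp add: dual_norm_scale dual_norm_curve)
qed (rule dual_norm_curve)

section \<open>Radial parametrization of the arcs\<close>

definition segment_point :: "'a \<Rightarrow> 'a \<Rightarrow> real \<Rightarrow> 'a" where
  "segment_point v w t = (1 - t) *\<^sub>R v + t *\<^sub>R w"

lemma segment_point_coords:
  assumes "\<omega> v w = 1"
  shows "\<omega> (segment_point v w t) w = 1 - t" "\<omega> v (segment_point v w t) = t"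
  using assms by (simp_all add: segment_point_def form_simps)

lemma segment_point_nonzero:
  assumes "\<omega> v w = 1"
  shows "segment_point v w t \<noteq> 0"
  using segment_point_coords[OF assms, of t] by (auto simp: form_simps)

text \<open>Central projection of the segment from \<open>v\<close> to \<open>w\<close> onto
  \<open>\<gamma>\<close>. The pair \<open>v\<close>, \<open>w\<close> gives the first arc of the
  construction, the pair \<open>w\<close>, \<open>- v\<close> the second.\<close>

definition radial_arc :: "'a \<Rightarrow> 'a \<Rightarrow> real \<Rightarrow> 'a" where
  "radial_arc v w t = (1 / dual_norm (segment_point v w t)) *\<^sub>R segment_point v w t"

lemma radial_arc_image:
  assumes "\<omega> v w = 1"
  shows "radial_arc v w ` {0..1} = {z \<in> \<gamma>. 0 \<le> \<omega> z w \<and> 0 \<le> \<omega> v z}"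
proof (intro subset_antisym subsetI)
  fix z assume "z \<in> radial_arc v w ` {0..1}"
  then obtain t where t: "t \<in> {0..1}" "z = radial_arc v w t" by blast
  have pos: "dual_norm (segment_point v w t) > 0"
    using dual_norm_pos segment_point_nonzero[OF assms] by blast
  then have "dual_norm z = 1" by (simp add: t(2) radial_arc_def dual_norm_scale)
  then show "z \<in> {z \<in> \<gamma>. 0 \<le> \<omega> z w \<and> 0 \<le> \<omega> v z}"
    using pos t(1) segment_point_coords[OF assms, of t]
    by (auto simp: curve_iff t(2) radial_arc_def form_simps)
next
  fix z assume "z \<in> {z \<in> \<gamma>. 0 \<le> \<omega> z w \<and> 0 \<le> \<omega> v z}"
  then have z: "z \<in> \<gamma>" "0 \<le> \<omega> z w" "0 \<le> \<omega> v z" by auto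
  \<comment> \<open>Inverse of the projection: division by the coordinate sum moves \<open>z\<close>
    onto the segment, to the parameter \<open>\<omega> v z / s\<close>.\<close>
  define s where "s = \<omega> z w + \<omega> v z"
  note zc = coordinates[OF assms, of z]
  have "s \<noteq> 0"
  proof
    assume "s = 0"
    then have "\<omega> z w = 0" "\<omega> v z = 0" using z by (auto simp: s_def)
    with zc have "z = 0" by simp
    with z curve_nonzero show False by blast
  qed
  with z have s: "s > 0" by (simp add: s_def)
  define t where "t = \<omega> v z / s"
  have t: "t \<in> {0..1}" using z s by (simp add: t_def s_def)
  have t': "1 - t = \<omega> z w / s" using s by (simp add: t_def field_simps) (simp add: s_def)
  have "segment_point v w t = (1 / s) *\<^sub>R (\<omega> z w *\<^sub>R v + \<omega> v z *\<^sub>R w)"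
    unfolding segment_point_def t' by (simp add: t_def scaleR_add_right)
  then have p: "segment_point v w t = (1 / s) *\<^sub>R z"
    unfolding zc[symmetric] .
  have "z = radial_arc v w t"
    using s dual_norm_curve[OF z(1)] by (simp add: radial_arc_def p dual_norm_scale)
  with t show "z \<in> radial_arc v w ` {0..1}" by blast
qed

lemma arc_radial_arc:
  assumes "\<omega> v w = 1"
  shows "arc (radial_arc v w)"
proof -
  have "continuous_on {0..1} (segment_point v w)"
    unfolding segment_point_def by (intro continuous_intros)
  moreover have "dual_norm (segment_point v w t) \<noteq> 0" for t
    using dual_norm_pos[OF segment_point_nonzero[OF assms, of t]] by simp
  ultimately have "path (radial_arc v w)"
    unfolding path_def radial_arc_def
    by (intro continuous_intros continuous_on_compose2[OF continuous_dual_norm]) auto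
  moreover have "inj_on (radial_arc v w) {0..1}"
  proof (rule inj_onI)
    fix s t assume eq: "radial_arc v w s = radial_arc v w t"
    have pos: "dual_norm (segment_point v w r) > 0" for r
      using dual_norm_pos segment_point_nonzero[OF assms] by blast
    \<comment> \<open>On the segment points at \<open>s\<close> and \<open>t\<close> the form has
      the value \<open>t - s\<close>, so its vanishing separates the parameters.\<close>
    have "\<omega> (radial_arc v w s) (radial_arc v w t) = 0" using eq by simp
    then have "\<omega> (segment_point v w s) (segment_point v w t) = 0"
      using pos[of s] pos[of t] by (simp add: radial_arc_def form_simps)
    then show "s = t"
      unfolding form_coordinates[OF assms, of "segment_point v w s"] segment_point_coords[OF assms]
      by (simp add: algebra_simps)
  qed
  ultimately show ?thesis by (simp add: arc_def)
qed

text \<open>Three inequalities cut out \<open>Q\<close>, and their strict versions its interior. On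
  the frontier one of them is therefore an equality, which gives the arc and the two
  segments.\<close>

lemma sector_body:
  assumes vw: "\<omega> v w = 1" and "v \<in> \<gamma>" "w \<in> \<gamma>"
  defines "Q \<equiv> {z \<in> K. 0 \<le> \<omega> z w \<and> 0 \<le> \<omega> v z}"
  shows "convex_body Q"
    and "frontier Q = {z \<in> \<gamma>. 0 \<le> \<omega> z w \<and> 0 \<le> \<omega> v z} \<union> closed_segment 0 v \<union> closed_segment 0 w"
proof -
  have Q: "Q = K \<inter> ((\<lambda>z. \<omega> z w) -` {0..} \<inter> (\<lambda>z. \<omega> v z) -` {0..})"
    by (auto simp: Q_def)
  have "convex Q" unfolding Q
    by (intro convex_Int convex_body convex_linear_vimage linear_left linear_right) auto
  have "closed ((\<lambda>z. \<omega> z w) -` {0..} \<inter> (\<lambda>z. \<omega> v z) -` {0..})"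
    by (intro closed_Int closed_vimage continuous_intros)
  then have "compact Q" unfolding Q using compact_body by (rule compact_Int_closed[rotated])
  define I where "I = {z. dual_norm z < 1 \<and> 0 < \<omega> z w \<and> 0 < \<omega> v z}"
  have int: "interior Q = I"
  proof
    have "open I" unfolding I_def
      by (intro open_Collect_conj open_Collect_less continuous_intros continuous_dual_norm)
    moreover have "I \<subseteq> Q" by (auto simp: I_def Q_def body_iff)
    ultimately show "I \<subseteq> interior Q" by (rule interior_maximal[rotated])
  next
    show "interior Q \<subseteq> I"
    proof
      fix z assume "z \<in> interior Q"
      then obtain e where e: "e > 0" "cball z e \<subseteq> Q" by (auto simp: mem_interior_cball)
      \<comment> \<open>An interior point can be moved slightly in any direction. Moving by
        \<open>- v\<close> and \<open>- w\<close> makes both coordinates strictly positive, moving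
        along \<open>z\<close> makes its norm strictly less than 1.\<close>
      have shift: "\<exists>d>0. z + d *\<^sub>R y \<in> Q" for y
      proof (cases "y = 0")
        case False
        then have "z + (e / norm y) *\<^sub>R y \<in> cball z e" using e by (simp add: dist_norm)
        then show ?thesis using e False by (intro exI[of _ "e / norm y"]) auto
      qed (use e in \<open>auto intro!: exI[of _ 1]\<close>)
      obtain d1 where d1: "d1 > 0" "z + d1 *\<^sub>R (- v) \<in> Q" using shift by blast
      obtain d2 where d2: "d2 > 0" "z + d2 *\<^sub>R (- w) \<in> Q" using shift by blast
      obtain d where d: "d > 0" "z + d *\<^sub>R z \<in> Q" using shift by blast
      have pos: "0 < \<omega> z w" "0 < \<omega> v z"
        using d1 d2 vw by (auto simp: Q_def form_simps)
      then have "z \<noteq> 0" by (auto simp: form_simps)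
      have "z + d *\<^sub>R z = (1 + d) *\<^sub>R z" by (simp add: algebra_simps)
      then have "(1 + d) * dual_norm z \<le> 1" using d by (simp add: Q_def body_iff dual_norm_scale)
      moreover have "dual_norm z < (1 + d) * dual_norm z" using dual_norm_pos[OF \<open>z \<noteq> 0\<close>] d by simp
      ultimately show "z \<in> I" using pos by (simp add: I_def)
    qed
  qed
  have "(1 / (2 * dual_norm (v + w))) *\<^sub>R (v + w) \<in> I"
  proof -
    have "v + w \<noteq> 0" using segment_point_nonzero[OF vw, of "1/2"] 
      by (auto simp: segment_point_def simp flip: scaleR_add_right)
    then have "dual_norm (v + w) > 0" by (rule dual_norm_pos)
    then show ?thesis using vw by (simp add: I_def dual_norm_scale form_simps)
  qed
  with \<open>compact Q\<close> \<open>convex Q\<close> int show "convex_body Q" by (auto simp: convex_body_def)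
  have "frontier Q = Q - I"
    using \<open>compact Q\<close> by (simp add: frontier_def int compact_imp_closed)
  also have "\<dots> = {z \<in> \<gamma>. 0 \<le> \<omega> z w \<and> 0 \<le> \<omega> v z} \<union> closed_segment 0 v \<union> closed_segment 0 w"
    (is "_ = ?A \<union> ?V \<union> ?W")
  proof -
    have axis: "s *\<^sub>R x \<in> K \<longleftrightarrow> s \<le> 1" if "x \<in> \<gamma>" "0 \<le> s" for x s
      using that by (simp add: body_iff dual_norm_scale dual_norm_curve)
    have V: "?V = {z \<in> Q. \<omega> v z = 0}"
    proof (intro set_eqI iffI)
      fix z assume "z \<in> {z \<in> Q. \<omega> v z = 0}"
      moreover from this have "z = \<omega> z w *\<^sub>R v" using coordinates[OF vw, of z] by simp
      ultimately show "z \<in> ?V" using axis[OF \<open>v \<in> \<gamma>\<close>, of "\<omega> z w"]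
        by (auto simp: Q_def in_segment)
    qed (auto simp: in_segment Q_def form_simps vw axis \<open>v \<in> \<gamma>\<close>)
    have W: "?W = {z \<in> Q. \<omega> z w = 0}"
    proof (intro set_eqI iffI)
      fix z assume "z \<in> {z \<in> Q. \<omega> z w = 0}"
      moreover from this have "z = \<omega> v z *\<^sub>R w" using coordinates[OF vw, of z] by simp
      ultimately show "z \<in> ?W" using axis[OF \<open>w \<in> \<gamma>\<close>, of "\<omega> v z"]
        by (auto simp: Q_def in_segment)
    qed (auto simp: in_segment Q_def form_simps vw axis \<open>w \<in> \<gamma>\<close>)
    show ?thesis unfolding V W by (auto simp: Q_def I_def body_iff curve_iff)
  qed
  finally show "frontier Q = ?A \<union> ?V \<union> ?W" .
qed

lemma radon_curve: "radon_curve \<gamma>"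
proof -
  obtain y where y: "y \<in> \<gamma>" by (rule dual_norm_attained)
  with self_polar obtain w where w: "w \<in> \<gamma>" "\<bar>\<omega> w y\<bar> = 1" by (auto simp: self_polar_def)
  \<comment> \<open>The factor is 1 or -1 and is chosen so that \<open>\<omega> v w\<close> is 1
    rather than -1.\<close>
  define v where "v = \<omega> y w *\<^sub>R y"
  have "\<omega> y w = 1 \<or> \<omega> y w = -1" using w(2) antisym[of y w] by linarith
  then have v: "v \<in> \<gamma>" "\<omega> v w = 1" using y by (auto simp: v_def form_simps)
  define \<gamma>1 where "\<gamma>1 = {z \<in> \<gamma>. 0 \<le> \<omega> z w \<and> 0 \<le> \<omega> v z}"
  have vw1: "v \<in> \<gamma>1" "w \<in> \<gamma>1" using v w by (auto simp: \<gamma>1_def)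
  define g where "g = radial_arc v w"
  have image: "path_image g = \<gamma>1"
    using radial_arc_image[OF v(2)] by (simp add: path_image_def g_def \<gamma>1_def)
  have ends: "pathstart g = v" "pathfinish g = w"
    using v(1) w(1) by (simp_all add: g_def pathstart_def pathfinish_def radial_arc_def segment_point_def dual_norm_curve)
  \<comment> \<open>The coordinates are pairings with the points \<open>w\<close> and
    \<open>v\<close> of \<open>\<gamma>\<close>, so self-polarity bounds them by 1.\<close>
  have hull: "\<gamma>1 \<subseteq> convex hull {0, v, w, v + w}"
    using curve_bound[OF _ w(1)] curve_bound[OF v(1)] parallelogram_hull[OF v(2)]
    by (auto simp: \<gamma>1_def) fastforce+
  \<comment> \<open>This identifies the normalizing factor in \<open>radon_arc2\<close>, and makes
    the second arc a radial arc on \<open>\<gamma>\<close>.\<close>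
  have sup: "(SUP x\<in>\<gamma>1. \<bar>\<omega> x (segment_point w (- v) t)\<bar>) = dual_norm (segment_point w (- v) t)"
    (is "?S = dual_norm ?u") if t: "t \<in> {0..1}" for t
  proof (rule order_antisym)
    have upper: "\<bar>\<omega> x ?u\<bar> \<le> ?S" if "x \<in> \<gamma>1" for x
      using that dual_norm_upper by (intro cSUP_upper bdd_aboveI2[of _ _ "dual_norm ?u"]) (auto simp: \<gamma>1_def)
    show "?S \<le> dual_norm ?u" using vw1 dual_norm_upper by (intro cSUP_least) (auto simp: \<gamma>1_def)
    have form_u: "\<omega> x ?u = (1 - t) * \<omega> x w + t * \<omega> v x" for x
      using antisym[of x v] by (simp add: segment_point_def form_simps)
    have S: "1 - t \<le> ?S" "t \<le> ?S"
      using upper[OF vw1(1)] upper[OF vw1(2)] t v by (auto simp: form_u)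
    obtain x where x: "x \<in> \<gamma>" "dual_norm ?u = \<bar>\<omega> x ?u\<bar>" by (rule dual_norm_attained)
    define a b where "a = \<omega> x w" and "b = \<omega> v x"
    have ab: "\<bar>a\<bar> \<le> 1" "\<bar>b\<bar> \<le> 1" using curve_bound x v w by (auto simp: a_def b_def)
    \<comment> \<open>In the last two cases the two terms of \<open>form_u\<close> have opposite
      signs, so the absolute value is at most the larger of \<open>1 - t\<close> and
      \<open>t\<close>, which are the values at \<open>v\<close> and \<open>w\<close>.\<close>
    consider "x \<in> \<gamma>1" | "- x \<in> \<gamma>1" | "a \<le> 0" "0 \<le> b" | "0 \<le> a" "b \<le> 0"
      using x by (auto simp: \<gamma>1_def a_def b_def form_simps) linarith
    then have "\<bar>\<omega> x ?u\<bar> \<le> ?S"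
    proof cases
      case 2
      then show ?thesis using upper[of "- x"] by (simp add: form_simps)
    next
      case 3
      have "(1 - t) * - a \<le> 1 - t" "t * b \<le> t" "0 \<le> (1 - t) * - a" "0 \<le> t * b"
        using 3 t ab mult_left_le[of "- a" "1 - t"] mult_left_le[of b t]
          mult_nonneg_nonneg[of "1 - t" "- a"] by simp_all
      then show ?thesis using S unfolding form_u a_def[symmetric] b_def[symmetric] by linarith
    next
      case 4
      have "(1 - t) * a \<le> 1 - t" "t * - b \<le> t" "0 \<le> (1 - t) * a" "0 \<le> t * - b"
        using 4 t ab mult_left_le[of a "1 - t"] mult_left_le[of "- b" t]
          mult_nonneg_nonneg[of t "- b"] by simp_all
      then show ?thesis using S unfolding form_u a_def[symmetric] b_def[symmetric] by linarith
    qed (rule upper)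
    then show "dual_norm ?u \<le> ?S" by (simp add: x)
  qed
  define \<gamma>2 where "\<gamma>2 = radon_arc2 \<omega> v w \<gamma>1 ` {0..1}"
  have "radon_arc2 \<omega> v w \<gamma>1 t = radial_arc w (- v) t" if "t \<in> {0..1}" for t
    using sup[OF that] by (simp add: radon_arc2_def Let_def radial_arc_def segment_point_def)
  then have "\<gamma>2 = radial_arc w (- v) ` {0..1}" unfolding \<gamma>2_def by (rule image_cong[OF refl])
  \<comment> \<open>The pair \<open>w\<close>, \<open>- v\<close> again has form value 1.\<close>
  also have "\<dots> = {z \<in> \<gamma>. 0 \<le> \<omega> z (- v) \<and> 0 \<le> \<omega> w z}"
    using v(2) antisym[of v w] by (intro radial_arc_image) (simp add: form_simps)
  also have "\<dots> = {z \<in> \<gamma>. \<omega> z w \<le> 0 \<and> 0 \<le> \<omega> v z}"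
    using antisym[of v] antisym[of w] by (auto simp: form_simps)
  finally have \<gamma>2: "\<gamma>2 = \<dots>" .
  have "\<gamma> = \<gamma>1 \<union> \<gamma>2 \<union> uminus ` \<gamma>1 \<union> uminus ` \<gamma>2"
  proof (intro subset_antisym subsetI)
    fix z assume z: "z \<in> \<gamma>"
    then have "z \<in> \<gamma>1 \<or> z \<in> \<gamma>2 \<or> - z \<in> \<gamma>1 \<or> - z \<in> \<gamma>2"
      by (auto simp: \<gamma>1_def \<gamma>2 form_simps)
    then show "z \<in> \<gamma>1 \<union> \<gamma>2 \<union> uminus ` \<gamma>1 \<union> uminus ` \<gamma>2"
      by (metis UnCI imageI minus_minus)
  qed (auto simp: \<gamma>1_def \<gamma>2)
  moreover have "\<exists>Q. convex_body Q \<and> frontier Q = \<gamma>1 \<union> closed_segment 0 v \<union> closed_segment 0 w"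
    using sector_body[OF v(2) v(1) w(1)] unfolding \<gamma>1_def by blast
  ultimately show ?thesis
    unfolding radon_curve_def
    using normalized_independent[OF v(2)] symplectic v(2) arc_radial_arc[OF v(2)] ends image hull \<gamma>2_def
    unfolding g_def by blast
qed

end

section \<open>The equivalence, after rescaling the form to constant 1\<close>

theorem proposition5p1:
  fixes B :: "'a::euclidean_space \<Rightarrow> 'a \<Rightarrow> real" and \<gamma> :: "'a set"
  assumes "DIM('a) = 2"
    and "symplectic_form B"
    and "\<exists>p. path p \<and> pathfinish p = pathstart p \<and> path_image p = \<gamma>"
    and "\<exists>K. convex_body K \<and> \<gamma> = frontier K"
    and "\<gamma> = uminus ` \<gamma>"
  shows "radon_curve \<gamma> \<longleftrightarrow>
    (\<exists>c>0. \<forall>x\<in>\<gamma>. \<forall>y\<in>\<gamma>. direction_supports y (convex hull \<gamma>) x \<longrightarrow> \<bar>B x y\<bar> = c)"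
proof -
  obtain K where K: "convex_body K" "\<gamma> = frontier K" using assms(4) by blast
  interpret symplectic_body B K \<gamma>
    using assms K by unfold_locales auto
  have "radon_curve \<gamma> \<longleftrightarrow> (\<exists>c>0. self_polar (\<lambda>x y. B x y / c) \<gamma>)"
  proof
    assume "radon_curve \<gamma>"
    then obtain v w \<omega> g \<gamma>1 \<gamma>2 where \<omega>: "symplectic_form \<omega>" "\<omega> v w = 1"
      and g: "arc g" "pathstart g = v" "pathfinish g = w" "\<gamma>1 = path_image g"
      and hull: "\<gamma>1 \<subseteq> convex hull {0, v, w, v + w}"
      and \<gamma>2: "\<gamma>2 = radon_arc2 \<omega> v w \<gamma>1 ` {0..1}"
      and \<gamma>: "\<gamma> = \<gamma>1 \<union> \<gamma>2 \<union> uminus ` \<gamma>1 \<union> uminus ` \<gamma>2"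
      unfolding radon_curve_def by metis
    interpret N: symplectic_body \<omega> K \<gamma>
      using assms \<omega>(1) by unfold_locales
    have "v \<in> \<gamma>1" "w \<in> \<gamma>1" "compact \<gamma>1"
      using g by (auto simp: compact_arc_image)
    then have polar: "self_polar \<omega> \<gamma>"
      using N.radon_imp_self_polar \<omega>(2) hull \<gamma>2 \<gamma> by blast
    obtain k where k: "k \<noteq> 0" "\<And>x y. B x y = k * \<omega> x y"
      using symplectic_forms_proportional[OF symplectic_plane_axioms N.symplectic_plane_axioms] by metis
    \<comment> \<open>The constant is \<open>\<bar>k\<bar>\<close>, since the normalized form may
      differ from \<open>B\<close> by a factor of either sign.\<close>
    have "\<bar>B x y / \<bar>k\<bar>\<bar> = \<bar>\<omega> x y\<bar>" for x y using k by (simp add: abs_mult)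
    with polar have "self_polar (\<lambda>x y. B x y / \<bar>k\<bar>) \<gamma>" by (simp add: self_polar_def)
    with k(1) show "\<exists>c>0. self_polar (\<lambda>x y. B x y / c) \<gamma>" by (metis zero_less_abs_iff)
  next
    assume "\<exists>c>0. self_polar (\<lambda>x y. B x y / c) \<gamma>"
    then obtain c where c: "c > 0" "self_polar (\<lambda>x y. B x y / c) \<gamma>" by blast
    \<comment> \<open>The rescaled form \<open>B x y / c\<close> becomes the normalized form of the
      construction.\<close>
    have "bilinear (\<lambda>x y. B x y / c)"
      using bilin by (auto simp: bilinear_def linear_iff add_divide_distrib)
    then have "symplectic_form (\<lambda>x y. B x y / c)"
      using c(1) nondegenerate by (auto simp: symplectic_form_def)
    then interpret self_polar_body "\<lambda>x y. B x y / c" K \<gamma>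
      using assms c(2) by unfold_locales
    show "radon_curve \<gamma>" by (rule radon_curve)
  qed
  then show ?thesis by (metis support_condition_iff)
qed

end
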